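(* Let $(\varSigma^2,\mathrm{d}s^2)$ be a Riemannian surface, let $\ell$ be a geodesic of $\varSigma^2$, let $\psi(u,v)$ be semi-geodesic coordinates around $\ell$ on a neighborhood $\mathcal{U}$, with metric $\mathrm{d}s^2=\mathrm{d}u^2+G^2(u,v)\,\mathrm{d}v^2$, $G>0$ smooth, and let $\alpha\in\mathbb{R}$. Let $\gamma(t)=\psi(u(t),v(t))$, $t\in[a,b]$, be a smooth curve in $\mathcal{U}_+=\{\psi(u,v)\in\mathcal{U}:u>0\}$. Then $\gamma$ is an $\alpha$-catenary with respect to $\ell$ if, and only if, it satisfies $$\dot v\,u^\alpha G\left(\kappa-\alpha\frac{G\dot v}{u\,\Vert\dot\gamma\Vert}\right)=0\quad\text{and}\quad \dot u\,u^\alpha G\left(\kappa-\alpha\frac{G\dot v}{u\,\Vert\dot\gamma\Vert}\right)=0,$$ where $\kappa$ is the (signed) geodesic curvature of $\gamma$. In addition, if $\gamma$ is regular, then $\gamma$ is an $\alpha$-catenary with respect to $\ell$ if, and only if, $$\kappa=\alpha\frac{G\dot v}{u\,\Vert\dot\gamma\Vert}=\alpha\frac{G\dot v}{u\sqrt{\dot u^2+G^2\dot v^2}}.$$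
   Context: Semi-geodesic coordinates: let $\ell:I\to\varSigma^2$ be a geodesic parametrized by arc length $v$ and $X(v)$ a unit vector field along $\ell$ orthogonal to $\ell$. Then $\psi(u,v)=\exp_{\ell(v)}(uX(v))$ parametrizes a neighborhood $\mathcal{U}$ of $\ell$; $\ell$ is the curve $v\mapsto\psi(0,v)$, the metric is $\mathrm{d}s^2=\mathrm{d}u^2+G^2(u,v)\,\mathrm{d}v^2$ with $G>0$ smooth, and the distance from $\psi(u,v)\in\mathcal U$ to $\ell$ is $|u|$. In all formulas $G$ and its partial derivatives $G_u,G_v$ are evaluated along the curve, a dot denotes $\mathrm{d}/\mathrm{d}t$, and $\Vert\dot\gamma\Vert=\sqrt{\dot u^2+G^2\dot v^2}$. $\alpha$-catenary: a curve $\gamma=\psi(u(t),v(t)):[a,b]\to\mathcal{U}_+$ is an $\alpha$-catenary with respect to $\ell$ if it is a critical point of $$\mathcal{E}[\gamma]=\int_a^b \mathrm{dist}(\gamma(t),\ell)^\alpha\,\Vert\dot\gamma(t)\Vert\,\mathrm{d}t=\int_a^b u^\alpha\sqrt{\dot u^2+G^2(u,v)\dot v^2}\,\mathrm{d}t,$$ i.e. $(u(t),v(t))$ satisfies the Euler-Lagrange equations of $\mathcal{E}$. The signed geodesic curvature is taken with the sign convention given by $$\kappa=-\frac{\dot v(G_v\dot u\dot v+2G_u\dot u^2+G^2G_u\dot v^2)+G(\dot u\ddot v-\ddot u\dot v)}{(\dot u^2+G^2\dot v^2)^{3/2}}.$$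
   Formalization: For curves with zero-velocity points, where the Euler-Lagrange equations and the curvature are undefined, being an α-catenary is taken to mean satisfying the Euler-Lagrange equations at the times of nonzero velocity; regular curves are unaffected. *)

theory Defs
  imports "HOL-Analysis.Analysis"
begin

text \<open>
  Derivatives are taken within \<open>S\<close>, so the same notion serves open sets and compact intervals
  (with one-sided derivatives at the end points).
\<close>

primrec Ck_on :: "nat \<Rightarrow> 'a::real_normed_vector set \<Rightarrow> ('a \<Rightarrow> 'b::real_normed_vector) \<Rightarrow> bool" where
  "Ck_on 0 S f \<longleftrightarrow> continuous_on S f"
| "Ck_on (Suc k) S f \<longleftrightarrow> f differentiable_on S \<and>
     (\<forall>w. Ck_on k S (\<lambda>x. frechet_derivative f (at x within S) w))"

definition smooth_on :: "'a::real_normed_vector set \<Rightarrow> ('a \<Rightarrow> 'b::real_normed_vector) \<Rightarrow> bool" where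
  "smooth_on S f \<longleftrightarrow> (\<forall>k. Ck_on k S f)"


section \<open>Riemannian surfaces\<close>

type_synonym 'a chart = "'a set \<times> ('a \<Rightarrow> real \<times> real)"

text \<open>A tangent vector is given by its components with respect to every chart.\<close>

type_synonym 'a tvec = "'a chart \<Rightarrow> real \<times> real"

text \<open>
  \<open>metric S c z x y\<close> is the inner product of the tangent vectors with components \<open>x\<close> and \<open>y\<close>
  with respect to the chart \<open>c\<close>, at the point with coordinates \<open>z\<close>.
\<close>

record 'a surface =
  topo :: "'a topology"
  charts :: "'a chart set"
  metric :: "'a chart \<Rightarrow> real \<times> real \<Rightarrow> real \<times> real \<Rightarrow> real \<times> real \<Rightarrow> real"

definition topological_chart :: "'a topology \<Rightarrow> 'a chart \<Rightarrow> bool" where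
  "topological_chart T c \<longleftrightarrow> openin T (fst c) \<and> open (snd c ` fst c) \<and>
     homeomorphic_map (subtopology T (fst c)) (top_of_set (snd c ` fst c)) (snd c)"

definition transition :: "'a chart \<Rightarrow> 'a chart \<Rightarrow> real \<times> real \<Rightarrow> real \<times> real" where
  "transition c d = snd d \<circ> inv_into (fst c) (snd c)"

definition smooth_transition :: "'a chart \<Rightarrow> 'a chart \<Rightarrow> bool" where
  "smooth_transition c d \<longleftrightarrow> smooth_on (snd c ` (fst c \<inter> fst d)) (transition c d)"

definition smooth_surface :: "('a, 'm) surface_scheme \<Rightarrow> bool" where
  "smooth_surface S \<longleftrightarrow>
     Hausdorff_space (topo S) \<and> second_countable (topo S) \<and>
     (\<Union>c\<in>charts S. fst c) = topspace (topo S) \<and>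
     (\<forall>c\<in>charts S. topological_chart (topo S) c) \<and>
     (\<forall>c\<in>charts S. \<forall>d\<in>charts S. smooth_transition c d)"

definition riemannian_surface :: "('a, 'm) surface_scheme \<Rightarrow> bool" where
  "riemannian_surface S \<longleftrightarrow> smooth_surface S \<and>
     (\<forall>c\<in>charts S. \<forall>z\<in>snd c ` fst c.
        bilinear (metric S c z) \<and>
        (\<forall>x y. metric S c z x y = metric S c z y x) \<and>
        (\<forall>x. x \<noteq> 0 \<longrightarrow> metric S c z x x > 0)) \<and>
     (\<forall>c\<in>charts S. \<forall>x y. smooth_on (snd c ` fst c) (\<lambda>z. metric S c z x y)) \<and>
     (\<forall>c\<in>charts S. \<forall>d\<in>charts S. \<forall>z\<in>snd c ` (fst c \<inter> fst d). \<forall>x y.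
        metric S c z x y =
        metric S d (transition c d z)
          (frechet_derivative (transition c d) (at z) x)
          (frechet_derivative (transition c d) (at z) y))"

text \<open>Charts belonging to the maximal atlas.\<close>

definition smooth_chart :: "('a, 'm) surface_scheme \<Rightarrow> 'a chart \<Rightarrow> bool" where
  "smooth_chart S c \<longleftrightarrow> topological_chart (topo S) c \<and>
     (\<forall>d\<in>charts S. smooth_transition c d \<and> smooth_transition d c)"

definition tangent_vector :: "('a, 'm) surface_scheme \<Rightarrow> 'a \<Rightarrow> 'a tvec \<Rightarrow> bool" where
  "tangent_vector S p \<xi> \<longleftrightarrow> (\<forall>c\<in>charts S. \<forall>d\<in>charts S. p \<in> fst c \<inter> fst d \<longrightarrow>
     \<xi> d = frechet_derivative (transition c d) (at (snd c p)) (\<xi> c))"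

text \<open>The value does not depend on the chart chosen, by the transformation law of the metric.\<close>

definition rinner :: "('a, 'm) surface_scheme \<Rightarrow> 'a \<Rightarrow> 'a tvec \<Rightarrow> 'a tvec \<Rightarrow> real" where
  "rinner S p \<xi> \<eta> =
     (let c = (SOME c. c \<in> charts S \<and> p \<in> fst c) in metric S c (snd c p) (\<xi> c) (\<eta> c))"

definition rnorm :: "('a, 'm) surface_scheme \<Rightarrow> 'a \<Rightarrow> 'a tvec \<Rightarrow> real" where
  "rnorm S p \<xi> = sqrt (rinner S p \<xi> \<xi>)"


section \<open>Curves, geodesics and distance\<close>

definition smooth_curve_on :: "('a, 'm) surface_scheme \<Rightarrow> real set \<Rightarrow> (real \<Rightarrow> 'a) \<Rightarrow> bool" where
  "smooth_curve_on S J \<gamma> \<longleftrightarrow> continuous_map (top_of_set J) (topo S) \<gamma> \<and>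
     (\<forall>c\<in>charts S. smooth_on {t\<in>J. \<gamma> t \<in> fst c} (snd c \<circ> \<gamma>))"

definition velocity :: "real set \<Rightarrow> (real \<Rightarrow> 'a) \<Rightarrow> real \<Rightarrow> 'a tvec" where
  "velocity J \<gamma> t = (\<lambda>c. vector_derivative (snd c \<circ> \<gamma>) (at t within J))"

definition speed :: "('a, 'm) surface_scheme \<Rightarrow> real set \<Rightarrow> (real \<Rightarrow> 'a) \<Rightarrow> real \<Rightarrow> real" where
  "speed S J \<gamma> t = rnorm S (\<gamma> t) (velocity J \<gamma> t)"

text \<open>
  The vector with components \<open>\<Gamma>\<^sup>k\<^sub>i\<^sub>j x\<^sup>i y\<^sup>j\<close>, characterised by the Koszul formula for vector fields with
  constant components.
\<close>

definition christoffel ::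
  "('a, 'm) surface_scheme \<Rightarrow> 'a chart \<Rightarrow> real \<times> real \<Rightarrow> real \<times> real \<Rightarrow> real \<times> real \<Rightarrow> real \<times> real" where
  "christoffel S c z x y = (THE w. \<forall>e. metric S c z w e =
     (frechet_derivative (\<lambda>z. metric S c z y e) (at z) x +
      frechet_derivative (\<lambda>z. metric S c z x e) (at z) y -
      frechet_derivative (\<lambda>z. metric S c z x y) (at z) e) / 2)"

definition geodesic_on :: "('a, 'm) surface_scheme \<Rightarrow> real set \<Rightarrow> (real \<Rightarrow> 'a) \<Rightarrow> bool" where
  "geodesic_on S J \<gamma> \<longleftrightarrow> smooth_curve_on S J \<gamma> \<and>
     (\<forall>c\<in>charts S. \<forall>t\<in>J. \<gamma> t \<in> fst c \<longrightarrow>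
        vector_derivative (\<lambda>s. velocity J \<gamma> s c) (at t within J) +
        christoffel S c (snd c (\<gamma> t)) (velocity J \<gamma> t c) (velocity J \<gamma> t c) = 0)"

text \<open>\<open>has_exp S p \<xi> q\<close>: the exponential map at \<open>p\<close> is defined at \<open>\<xi>\<close>, with value \<open>q\<close>.\<close>

definition has_exp :: "('a, 'm) surface_scheme \<Rightarrow> 'a \<Rightarrow> 'a tvec \<Rightarrow> 'a \<Rightarrow> bool" where
  "has_exp S p \<xi> q \<longleftrightarrow> (\<exists>\<gamma>. geodesic_on S {0..1} \<gamma> \<and> \<gamma> 0 = p \<and>
     (\<forall>c\<in>charts S. p \<in> fst c \<longrightarrow> velocity {0..1} \<gamma> 0 c = \<xi> c) \<and> \<gamma> 1 = q)"

definition curve_length :: "('a, 'm) surface_scheme \<Rightarrow> (real \<Rightarrow> 'a) \<Rightarrow> real" where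
  "curve_length S \<gamma> = integral {0..1} (speed S {0..1} \<gamma>)"

text \<open>
  Smooth curves may have zero speed here, so every piecewise smooth curve has a smooth
  reparametrization and the infimum is the usual Riemannian distance.
\<close>

definition rdist_to :: "('a, 'm) surface_scheme \<Rightarrow> 'a \<Rightarrow> 'a set \<Rightarrow> real" where
  "rdist_to S p A =
     Inf {curve_length S \<gamma> |\<gamma>. smooth_curve_on S {0..1} \<gamma> \<and> \<gamma> 0 = p \<and> \<gamma> 1 \<in> A}"


section \<open>Semi-geodesic coordinates\<close>

definition unit_normal_field ::
  "('a, 'm) surface_scheme \<Rightarrow> real set \<Rightarrow> (real \<Rightarrow> 'a) \<Rightarrow> (real \<Rightarrow> 'a tvec) \<Rightarrow> bool" where
  "unit_normal_field S I l X \<longleftrightarrow>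
     (\<forall>v\<in>I. tangent_vector S (l v) (X v)) \<and>
     (\<forall>c\<in>charts S. smooth_on {v\<in>I. l v \<in> fst c} (\<lambda>v. X v c)) \<and>
     (\<forall>v\<in>I. rinner S (l v) (X v) (X v) = 1 \<and> rinner S (l v) (X v) (velocity I l v) = 0)"

text \<open>The differential of a parametrization \<open>\<psi>\<close> at \<open>x\<close>, applied to \<open>w\<close>.\<close>

definition pushforward :: "(real \<times> real \<Rightarrow> 'a) \<Rightarrow> real \<times> real \<Rightarrow> real \<times> real \<Rightarrow> 'a tvec" where
  "pushforward \<psi> x w = (\<lambda>c. frechet_derivative (snd c \<circ> \<psi>) (at x) w)"

text \<open>
  \<open>\<psi>\<close> maps the open set \<open>D\<close> of coordinates \<open>(u, v)\<close> diffeomorphically onto the neighbourhood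
  \<open>\<psi> ` D\<close> of the geodesic \<open>l\<close>. The last two conditions express the metric through \<open>G\<close> and
  the requirement that the neighbourhood be small enough for \<open>\<bar>u\<bar>\<close> to be the distance to \<open>l\<close>.
\<close>

definition semigeodesic_coords ::
  "('a, 'm) surface_scheme \<Rightarrow> real set \<Rightarrow> (real \<Rightarrow> 'a) \<Rightarrow> (real \<Rightarrow> 'a tvec) \<Rightarrow>
   (real \<times> real) set \<Rightarrow> (real \<times> real \<Rightarrow> 'a) \<Rightarrow> (real \<times> real \<Rightarrow> real) \<Rightarrow> bool" where
  "semigeodesic_coords S I l X D \<psi> G \<longleftrightarrow>
     is_interval I \<and> open I \<and> I \<noteq> {} \<and>
     geodesic_on S I l \<and> (\<forall>v\<in>I. speed S I l v = 1) \<and>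
     unit_normal_field S I l X \<and>
     open D \<and> {0} \<times> I \<subseteq> D \<and> D \<subseteq> UNIV \<times> I \<and>
     (\<forall>(u, v)\<in>D. has_exp S (l v) (\<lambda>c. u *\<^sub>R X v c) (\<psi> (u, v))) \<and>
     inj_on \<psi> D \<and> smooth_chart S (\<psi> ` D, inv_into D \<psi>) \<and>
     smooth_on D G \<and> (\<forall>x\<in>D. G x > 0) \<and>
     (\<forall>x\<in>D. let \<psi>\<^sub>u = pushforward \<psi> x (1, 0); \<psi>\<^sub>v = pushforward \<psi> x (0, 1) in
        rinner S (\<psi> x) \<psi>\<^sub>u \<psi>\<^sub>u = 1 \<and> rinner S (\<psi> x) \<psi>\<^sub>u \<psi>\<^sub>v = 0 \<and>
        rinner S (\<psi> x) \<psi>\<^sub>v \<psi>\<^sub>v = (G x)\<^sup>2) \<and>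
     (\<forall>(u, v)\<in>D. rdist_to S (\<psi> (u, v)) (l ` I) = \<bar>u\<bar>)"


section \<open>Alpha-catenaries\<close>

abbreviation ddt :: "real \<Rightarrow> real \<Rightarrow> (real \<Rightarrow> real) \<Rightarrow> real \<Rightarrow> real" where
  "ddt a b f t \<equiv> vector_derivative f (at t within {a..b})"

text \<open>
  The Euler-Lagrange equations at time \<open>t\<close>, for the functional with integrand
  \<open>L u v (du/dt) (dv/dt)\<close>.
\<close>

definition euler_lagrange_at ::
  "(real \<Rightarrow> real \<Rightarrow> real \<Rightarrow> real \<Rightarrow> real) \<Rightarrow> real \<Rightarrow> real \<Rightarrow>
   (real \<Rightarrow> real) \<Rightarrow> (real \<Rightarrow> real) \<Rightarrow> real \<Rightarrow> bool" where
  "euler_lagrange_at L a b u v t \<longleftrightarrow>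
     ((\<lambda>s. deriv (\<lambda>p. L (u s) (v s) p (ddt a b v s)) (ddt a b u s)) has_real_derivative
        deriv (\<lambda>x. L x (v t) (ddt a b u t) (ddt a b v t)) (u t)) (at t within {a..b}) \<and>
     ((\<lambda>s. deriv (\<lambda>q. L (u s) (v s) (ddt a b u s) q) (ddt a b v s)) has_real_derivative
        deriv (\<lambda>y. L (u t) y (ddt a b u t) (ddt a b v t)) (v t)) (at t within {a..b})"

text \<open>The integrand \<open>dist(\<gamma>, A)\<^sup>\<alpha> \<parallel>\<gamma>'\<parallel>\<close> in the coordinates \<open>\<psi>\<close>.\<close>

definition catenary_lagrangian ::
  "('a, 'm) surface_scheme \<Rightarrow> (real \<times> real \<Rightarrow> 'a) \<Rightarrow> 'a set \<Rightarrow> real \<Rightarrow>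
   real \<Rightarrow> real \<Rightarrow> real \<Rightarrow> real \<Rightarrow> real" where
  "catenary_lagrangian S \<psi> A \<alpha> u v p q =
     rdist_to S (\<psi> (u, v)) A powr \<alpha> * rnorm S (\<psi> (u, v)) (pushforward \<psi> (u, v) (p, q))"

text \<open>
  The Lagrangian is not differentiable at zero velocity, so the Euler-Lagrange equations are
  only meaningful, and only imposed, at the times where the velocity of the curve is nonzero.
\<close>

definition alpha_catenary ::
  "('a, 'm) surface_scheme \<Rightarrow> (real \<times> real \<Rightarrow> 'a) \<Rightarrow> 'a set \<Rightarrow> real \<Rightarrow> real \<Rightarrow> real \<Rightarrow>
   (real \<Rightarrow> real) \<Rightarrow> (real \<Rightarrow> real) \<Rightarrow> bool" where
  "alpha_catenary S \<psi> A \<alpha> a b u v \<longleftrightarrow>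
     (\<forall>t\<in>{a..b}. (ddt a b u t, ddt a b v t) \<noteq> (0, 0) \<longrightarrow>
        euler_lagrange_at (catenary_lagrangian S \<psi> A \<alpha>) a b u v t)"

text \<open>
  In terms of the covariant acceleration \<open>A = (A\<^sup>u, A\<^sup>v)\<close> of the curve, this is
  \<open>-G (u' A\<^sup>v - v' A\<^sup>u) / \<parallel>\<gamma>'\<parallel>\<^sup>3\<close>. Its value is 0 where the velocity vanishes.
\<close>

definition geodesic_curvature ::
  "(real \<times> real \<Rightarrow> real) \<Rightarrow> real \<Rightarrow> real \<Rightarrow> (real \<Rightarrow> real) \<Rightarrow> (real \<Rightarrow> real) \<Rightarrow> real \<Rightarrow> real" where
  "geodesic_curvature G a b u v t =
     (let g = G (u t, v t);
          gu = deriv (\<lambda>x. G (x, v t)) (u t);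
          gv = deriv (\<lambda>y. G (u t, y)) (v t);
          u1 = ddt a b u t; u2 = ddt a b (ddt a b u) t;
          v1 = ddt a b v t; v2 = ddt a b (ddt a b v) t
      in - (v1 * (gv * u1 * v1 + 2 * gu * u1\<^sup>2 + g\<^sup>2 * gu * v1\<^sup>2) + g * (u1 * v2 - u2 * v1))
         / (u1\<^sup>2 + g\<^sup>2 * v1\<^sup>2) powr (3/2))"

end

theory Submission
  imports Defs
begin

text \<open>
  In the coordinates \<open>(u, v)\<close> the integrand is \<open>u\<^sup>\<alpha> W\<close> with \<open>W = sqrt (u'\<^sup>2 + G\<^sup>2 v'\<^sup>2)\<close>. Write \<open>E\<^sub>u\<close>, \<open>E\<^sub>v\<close>
  for the differences of the two sides of its Euler-Lagrange equations. As the integrand is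
  homogeneous of degree one in the velocity, \<open>u' E\<^sub>u + v' E\<^sub>v = 0\<close>, so the pair \<open>(E\<^sub>u, E\<^sub>v)\<close> is a
  multiple of \<open>(v', - u')\<close>; expanding the time derivatives identifies the factor as
  \<open>u\<^sup>\<alpha> G (\<kappa> - \<alpha> G v' / (u W))\<close>.
\<close>

section \<open>The metric in semi-geodesic coordinates\<close>

text \<open>In the chart inverse to \<open>\<psi>\<close>, the map
  \<open>snd c \<circ> \<psi>\<close> is a transition map, and \<open>smooth_chart\<close> makes all
  transitions to the atlas smooth. This makes the \<open>frechet_derivative\<close> inside
  \<open>pushforward\<close> a genuine derivative.\<close>

lemma semigeodesic_chart_comp_differentiable:
  assumes S: "riemannian_surface S" and co: "semigeodesic_coords S I l X D \<psi> G"
    and c: "c \<in> charts S" and x: "x \<in> D" and xc: "\<psi> x \<in> fst c"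
  shows "(snd c \<circ> \<psi>) differentiable at x"
proof -
  let ?e = "(\<psi> ` D, inv_into D \<psi>)"
  have inj: "inj_on \<psi> D" and e: "smooth_chart S ?e" and "open D"
    using co by (auto simp: semigeodesic_coords_def)
  have img: "inv_into D \<psi> ` \<psi> ` D = D"
    using inj by simp
  define V where "V = inv_into D \<psi> ` (\<psi> ` D \<inter> fst c)"
  have V: "V = {y\<in>D. \<psi> y \<in> fst c}"
    unfolding V_def using inj by (force simp: image_iff)
  have "openin (topo S) (fst c)"
    using S c by (auto simp: riemannian_surface_def smooth_surface_def topological_chart_def)
  then have "openin (subtopology (topo S) (\<psi> ` D)) (\<psi> ` D \<inter> fst c)"
    by (metis Int_commute openin_subtopology_Int)
  moreover have "homeomorphic_map (subtopology (topo S) (\<psi> ` D)) (top_of_set D) (inv_into D \<psi>)"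
    using e img by (simp add: smooth_chart_def topological_chart_def)
  \<comment> \<open>Charts are homeomorphisms, so the overlap has open image. Openness of
    \<open>V\<close> then turns differentiability within \<open>V\<close> into differentiability at
    \<open>x\<close>.\<close>
  ultimately have "openin (top_of_set D) V"
    unfolding V_def using homeomorphic_imp_open_map open_map_def by blast
  then have "open V" using \<open>open D\<close> by (meson openin_open_trans)
  have "smooth_on V (transition ?e c)"
    using e c by (simp add: smooth_chart_def smooth_transition_def V_def)
  then have "Ck_on (Suc 0) V (transition ?e c)" by (simp only: smooth_on_def)
  then have "transition ?e c differentiable_on V" by simp
  moreover have xV: "x \<in> V" using x xc V by simp
  ultimately have d: "transition ?e c differentiable at x"
    using \<open>open V\<close> by (metis differentiable_on_def at_within_open)
  \<comment> \<open>\<open>transition\<close> inverts the chart map, which is itself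
    \<open>inv_into D \<psi>\<close>. On \<open>V\<close> this double inverse is
    \<open>\<psi>\<close>.\<close>
  have eq: "transition ?e c y = (snd c \<circ> \<psi>) y" if "y \<in> V" for y
  proof -
    have "y \<in> D" using that V by simp
    have "inv_into D \<psi> (\<psi> y) = y" using inj \<open>y \<in> D\<close> by simp
    moreover have "inj_on (inv_into D \<psi>) (\<psi> ` D)" by (rule inj_on_inv_into) simp
    ultimately have "inv_into (\<psi> ` D) (inv_into D \<psi>) y = \<psi> y"
      using inv_into_f_f[of "inv_into D \<psi>" "\<psi> ` D" "\<psi> y"] \<open>y \<in> D\<close> by simp
    then show ?thesis by (simp add: transition_def)
  qed
  from d obtain F where "(transition ?e c has_derivative F) (at x)"
    by (auto simp: differentiable_def)
  then have "((snd c \<circ> \<psi>) has_derivative F) (at x)"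
    by (rule has_derivative_transform_within_open[OF _ \<open>open V\<close> xV]) (rule eq)
  then show ?thesis by (auto simp: differentiable_def)
qed

text \<open>Makes the choice in \<open>rinner\<close> harmless: \<open>\<psi> x\<close> lies in an
  open set of the surface, and the charts cover the surface.\<close>

lemma some_chart:
  assumes "riemannian_surface S" and co: "semigeodesic_coords S I l X D \<psi> G" and "x \<in> D"
    and "c = (SOME c. c \<in> charts S \<and> \<psi> x \<in> fst c)"
  shows "c \<in> charts S \<and> \<psi> x \<in> fst c"
proof -
  have "openin (topo S) (\<psi> ` D)"
    using co by (auto simp: semigeodesic_coords_def smooth_chart_def topological_chart_def)
  then have "\<psi> x \<in> topspace (topo S)"
    using openin_subset \<open>x \<in> D\<close> by blast
  then have "\<exists>c. c \<in> charts S \<and> \<psi> x \<in> fst c"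
    using assms(1) unfolding riemannian_surface_def smooth_surface_def by (metis UN_iff)
  then show ?thesis unfolding assms(4) by (rule someI_ex)
qed

text \<open>The differential is linear and the metric bilinear, so the square of the norm expands
  into the three inner products of the coordinate vectors, which are 1, 0 and
  \<open>(G x)\<^sup>2\<close>. All of them are evaluated in the same chosen chart, as the base
  point is the same.\<close>

lemma rnorm_pushforward:
  assumes S: "riemannian_surface S" and co: "semigeodesic_coords S I l X D \<psi> G" and x: "x \<in> D"
  shows "rnorm S (\<psi> x) (pushforward \<psi> x (p, q)) = sqrt (p\<^sup>2 + (G x)\<^sup>2 * q\<^sup>2)"
proof -
  define c where "c = (SOME c. c \<in> charts S \<and> \<psi> x \<in> fst c)"
  have c: "c \<in> charts S" "\<psi> x \<in> fst c" using some_chart[OF S co x c_def] by auto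
  define F where "F = frechet_derivative (snd c \<circ> \<psi>) (at x)"
  define g where "g = metric S c (snd c (\<psi> x))"
  have "((snd c \<circ> \<psi>) has_derivative F) (at x)"
    unfolding F_def using semigeodesic_chart_comp_differentiable[OF S co c(1) x c(2)]
    by (simp add: frechet_derivative_works)
  then have lin: "linear F" by (rule has_derivative_linear)
  have "(p, q) = p *\<^sub>R (1, 0) + q *\<^sub>R (0, 1 :: real)" by simp
  then have F: "F (p, q) = p *\<^sub>R F (1, 0) + q *\<^sub>R F (0, 1)"
    by (simp only: linear_add[OF lin] linear_scale[OF lin])
  have bil: "bilinear g" and sym: "g y z = g z y" for y z
    using S c unfolding riemannian_surface_def g_def by blast+
  have "g (F (p, q)) (F (p, q)) =
      p\<^sup>2 * g (F (1, 0)) (F (1, 0)) + 2 * p * q * g (F (1, 0)) (F (0, 1))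
      + q\<^sup>2 * g (F (0, 1)) (F (0, 1))"
    unfolding F using bil sym[of "F (0, 1)" "F (1, 0)"]
    by (simp add: bilinear_ladd bilinear_radd bilinear_lmul bilinear_rmul power2_eq_square
        algebra_simps)
  moreover have ri: "rinner S (\<psi> x) (pushforward \<psi> x w) (pushforward \<psi> x w') = g (F w) (F w')" for w w'
    by (simp add: rinner_def pushforward_def Let_def F_def g_def flip: c_def)
  moreover have "rinner S (\<psi> x) (pushforward \<psi> x (1, 0)) (pushforward \<psi> x (1, 0)) = 1"
     "rinner S (\<psi> x) (pushforward \<psi> x (1, 0)) (pushforward \<psi> x (0, 1)) = 0"
     "rinner S (\<psi> x) (pushforward \<psi> x (0, 1)) (pushforward \<psi> x (0, 1)) = (G x)\<^sup>2"
    using co x by (auto simp: semigeodesic_coords_def Let_def)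
  ultimately show ?thesis by (simp add: rnorm_def mult.commute)
qed

text \<open>For positive \<open>x\<close> the distance \<open>\<bar>x\<bar>\<close> is
  \<open>x\<close> itself. The geometric integrand becomes an explicit function that can be
  differentiated in each argument, but only over the points of \<open>D\<close>.\<close>

lemma catenary_lagrangian_eq:
  assumes "riemannian_surface S" and co: "semigeodesic_coords S I l X D \<psi> G"
    and "(x, y) \<in> D" and "x > 0"
  shows "catenary_lagrangian S \<psi> (l ` I) \<alpha> x y p q = x powr \<alpha> * sqrt (p\<^sup>2 + (G (x, y))\<^sup>2 * q\<^sup>2)"
proof -
  have "rdist_to S (\<psi> (x, y)) (l ` I) = x"
    using co assms(3,4) by (auto simp: semigeodesic_coords_def)
  then show ?thesis
    by (simp add: catenary_lagrangian_def rnorm_pushforward[OF assms(1-3)])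
qed

text \<open>By the chain rule, the velocity in a chart is the differential of \<open>\<psi>\<close>
  applied to \<open>(p, q)\<close>, so the norm formula for \<open>pushforward\<close>
  applies.\<close>

lemma speed_semigeodesic:
  assumes S: "riemannian_surface S" and co: "semigeodesic_coords S I l X D \<psi> G"
    and ab: "a < b" and t: "t \<in> {a..b}" and D: "(u t, v t) \<in> D"
    and eq: "\<forall>t\<in>{a..b}. \<gamma> t = \<psi> (u t, v t)"
    and u: "(u has_vector_derivative p) (at t within {a..b})"
    and v: "(v has_vector_derivative q) (at t within {a..b})"
  shows "speed S {a..b} \<gamma> t = sqrt (p\<^sup>2 + (G (u t, v t))\<^sup>2 * q\<^sup>2)"
proof -
  define c where "c = (SOME c. c \<in> charts S \<and> \<psi> (u t, v t) \<in> fst c)"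
  have c: "c \<in> charts S" "\<psi> (u t, v t) \<in> fst c" using some_chart[OF S co D c_def] by auto
  define F where "F = frechet_derivative (snd c \<circ> \<psi>) (at (u t, v t))"
  have F: "((snd c \<circ> \<psi>) has_derivative F) (at (u t, v t))"
    unfolding F_def using semigeodesic_chart_comp_differentiable[OF S co c(1) D c(2)]
    by (simp add: frechet_derivative_works)
  have uv: "((\<lambda>s. (u s, v s)) has_vector_derivative (p, q)) (at t within {a..b})"
    by (rule has_vector_derivative_Pair[OF u v])
  have "((snd c \<circ> \<psi>) \<circ> (\<lambda>s. (u s, v s)) has_vector_derivative F (p, q)) (at t within {a..b})"
    by (rule vector_derivative_diff_chain_within[OF uv])
       (rule has_derivative_at_withinI[OF F])
  then have "((snd c \<circ> \<gamma>) has_vector_derivative F (p, q)) (at t within {a..b})"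
    by (rule has_vector_derivative_transform[OF t, rotated]) (use eq in auto)
  then have vel: "velocity {a..b} \<gamma> t c = F (p, q)"
    unfolding velocity_def
    by (rule vector_derivative_within[rotated])
       (use ab t in \<open>simp add: trivial_limit_within\<close>)
  have "\<gamma> t = \<psi> (u t, v t)" using eq t by blast
  \<comment> \<open>\<open>rinner\<close> reads its vectors only in the chosen chart
    \<open>c\<close>, so agreement of velocity and pushforward in that chart suffices.\<close>
  then have "rinner S (\<gamma> t) (velocity {a..b} \<gamma> t) (velocity {a..b} \<gamma> t) =
    rinner S (\<psi> (u t, v t)) (pushforward \<psi> (u t, v t) (p, q)) (pushforward \<psi> (u t, v t) (p, q))"
    using vel by (simp add: rinner_def Let_def pushforward_def F_def flip: c_def)
  then show ?thesis
    using rnorm_pushforward[OF S co D, of p q] \<open>\<gamma> t = \<psi> (u t, v t)\<close>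
    by (simp add: speed_def rnorm_def)
qed

section \<open>The Euler-Lagrange equations\<close>

text \<open>Smoothness is phrased with \<open>frechet_derivative\<close>, the equations with
  \<open>vector_derivative\<close>. On a nondegenerate interval one-sided derivatives are unique, so
  \<open>ddt\<close> is the Frechet derivative applied to 1, and a second differentiation is
  allowed.\<close>

lemma smooth_on_ddt:
  assumes "smooth_on {a..b} f" and "a < b" and t: "t \<in> {a..b}"
  shows "(f has_vector_derivative ddt a b f t) (at t within {a..b})"
    and "(ddt a b f has_vector_derivative ddt a b (ddt a b f) t) (at t within {a..b})"
proof -
  let ?g = "\<lambda>t. frechet_derivative f (at t within {a..b}) 1"
  have "Ck_on (Suc (Suc 0)) {a..b} f" using assms(1) by (simp only: smooth_on_def)
  then have f: "f differentiable_on {a..b}" and g: "?g differentiable_on {a..b}" by auto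
  have *: "(f has_vector_derivative ddt a b f s) (at s within {a..b})" if "s \<in> {a..b}" for s
    using f that unfolding differentiable_on_def vector_derivative_works by blast
  show "(f has_vector_derivative ddt a b f t) (at t within {a..b})" using *[OF t] .
  have eq: "ddt a b f s = ?g s" if "s \<in> {a..b}" for s
  proof -
    have *: "(f has_derivative frechet_derivative f (at s within {a..b})) (at s within {a..b})"
      using f that by (auto simp: differentiable_on_def frechet_derivative_works)
    then have "(f has_vector_derivative ?g s) (at s within {a..b})"
      unfolding has_vector_derivative_def
    proof (rule has_derivative_eq_rhs, intro ext)
      fix r
      from linear_scale[OF has_derivative_linear[OF *], of r 1]
      show "frechet_derivative f (at s within {a..b}) r = r *\<^sub>R ?g s"
        by (simp only: real_scaleR_def mult_1_right)
    qed
    then show ?thesis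
      by (rule vector_derivative_within[rotated])
         (use \<open>a < b\<close> that in \<open>simp add: trivial_limit_within\<close>)
  qed
  have "(?g has_vector_derivative vector_derivative ?g (at t within {a..b})) (at t within {a..b})"
    using g t unfolding differentiable_on_def vector_derivative_works by blast
  then have "(ddt a b f has_vector_derivative vector_derivative ?g (at t within {a..b}))
      (at t within {a..b})"
    by (rule has_vector_derivative_transform[OF t, rotated]) (use eq in auto)
  then show "(ddt a b f has_vector_derivative ddt a b (ddt a b f) t) (at t within {a..b})"
    using vector_derivative_works differentiableI_vector by blast
qed

text \<open>Derivatives within a nondegenerate interval are unique. This turns each Euler-Lagrange
  equation, which asserts that a derivative exists with a given value, into the vanishing of a
  residual.\<close>

lemma has_real_derivative_iff_eq_Icc:
  fixes f :: "real \<Rightarrow> real"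
  assumes "a < b" and "t \<in> {a..b}" and A: "(f has_real_derivative A) (at t within {a..b})"
  shows "(f has_real_derivative B) (at t within {a..b}) \<longleftrightarrow> A - B = 0"
proof -
  have "at t within {a..b} \<noteq> bot"
    using assms(1,2) by (simp add: trivial_limit_within)
  then have "A = B" if "(f has_real_derivative B) (at t within {a..b})"
    using A that by (metis has_real_derivative_iff_has_vector_derivative vector_derivative_within)
  then show ?thesis using A by auto
qed

section \<open>Calculus of the speed and of \<open>G\<close>\<close>

lemma speed_sq_pos: "0 < p\<^sup>2 + g\<^sup>2 * q\<^sup>2" if "(p, q) \<noteq> (0, 0)" "g > 0" for p q g :: real
proof (cases "q = 0")
  case False
  then show ?thesis using that by (intro add_nonneg_pos) auto
qed (use that in auto)

text \<open>All three entries vary, so one computation gives the time derivative of the speed and,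
  with the other entries held constant, each partial derivative of the integrand's square
  root.\<close>

lemma has_real_derivative_sqrt_form:
  fixes p q g :: "real \<Rightarrow> real"
  assumes p: "(p has_real_derivative p') (at t within T)"
    and g: "(g has_real_derivative g') (at t within T)"
    and q: "(q has_real_derivative q') (at t within T)"
    and pos: "(p t)\<^sup>2 + (g t)\<^sup>2 * (q t)\<^sup>2 > 0"
  shows "((\<lambda>s. sqrt ((p s)\<^sup>2 + (g s)\<^sup>2 * (q s)\<^sup>2)) has_real_derivative
    (p t * p' + g t * g' * (q t)\<^sup>2 + (g t)\<^sup>2 * q t * q') / sqrt ((p t)\<^sup>2 + (g t)\<^sup>2 * (q t)\<^sup>2))
    (at t within T)"
proof -
  have r: "inverse r / 2 * (2 * n) = n / r" for r n :: real
    by (simp add: inverse_eq_divide)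
  have "((\<lambda>s. (p s)\<^sup>2 + (g s)\<^sup>2 * (q s)\<^sup>2) has_real_derivative
      2 * (p t * p' + g t * g' * (q t)\<^sup>2 + (g t)\<^sup>2 * q t * q')) (at t within T)"
    by (rule derivative_eq_intros p g q refl)+ (simp add: algebra_simps power2_eq_square)
  from DERIV_chain2[OF DERIV_real_sqrt[OF pos] this] show ?thesis
    by (simp only: r)
qed

text \<open>Links the slice derivatives of \<open>G\<close> that occur in the curvature and in the
  equations with the total derivative that the chain rule along the curve produces.\<close>

lemma has_derivative_prod_partials:
  fixes G :: "real \<times> real \<Rightarrow> real"
  assumes G: "(G has_derivative F) (at (x, y))"
  shows "((\<lambda>r. G (r, y)) has_real_derivative F (1, 0)) (at x)"
    and "((\<lambda>r. G (x, r)) has_real_derivative F (0, 1)) (at y)"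
    and "F (p, q) = p * F (1, 0) + q * F (0, 1)"
proof -
  have lin: "linear F" using G by (rule has_derivative_linear)
  have "(p, q) = p *\<^sub>R (1, 0) + q *\<^sub>R (0, 1 :: real)" by simp
  then show "F (p, q) = p * F (1, 0) + q * F (0, 1)"
    by (simp only: linear_add[OF lin] linear_scale[OF lin] real_scaleR_def)
  have "((\<lambda>r. (r, y)) has_vector_derivative (1, 0)) (at x)"
    by (intro has_vector_derivative_Pair has_vector_derivative_id has_vector_derivative_const)
  from vector_derivative_diff_chain_within[OF this has_derivative_at_withinI[OF G]]
  show "((\<lambda>r. G (r, y)) has_real_derivative F (1, 0)) (at x)"
    by (simp add: has_real_derivative_iff_has_vector_derivative o_def)
  have "((\<lambda>r. (x, r)) has_vector_derivative (0, 1)) (at y)"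
    by (intro has_vector_derivative_Pair has_vector_derivative_id has_vector_derivative_const)
  from vector_derivative_diff_chain_within[OF this has_derivative_at_withinI[OF G]]
  show "((\<lambda>r. G (x, r)) has_real_derivative F (0, 1)) (at y)"
    by (simp add: has_real_derivative_iff_has_vector_derivative o_def)
qed

text \<open>Pure algebra at a fixed time: \<open>x\<close>, \<open>p\<close>, \<open>q\<close>,
  \<open>g\<close> stand for \<open_u>, its velocity components and \<open>G\<close>.\<close>

lemma euler_lagrange_residuals:
  fixes x p q g gu gv p' q' z W W' K \<alpha> :: real
  assumes "x > 0" "W > 0" and W2: "W\<^sup>2 = p\<^sup>2 + g\<^sup>2 * q\<^sup>2"
    and W': "W' = (p * p' + g * (gu * p + gv * q) * q\<^sup>2 + g\<^sup>2 * q * q') / W"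
    and K: "K = - (q * (gv * p * q + 2 * gu * p\<^sup>2 + g\<^sup>2 * gu * q\<^sup>2) + g * (p * q' - p' * q)) / W ^ 3
                - \<alpha> * (g * q / (x * W))"
  shows "(\<alpha> * (z / x) * p * p + z * p') / W - z * p * W' / W\<^sup>2
           - (\<alpha> * (z / x) * W + z * (g * gu * q\<^sup>2 / W)) = q * z * g * K"
    and "(\<alpha> * (z / x) * p * (g\<^sup>2 * q) + z * (2 * g * (gu * p + gv * q) * q + g\<^sup>2 * q')) / W
           - z * (g\<^sup>2 * q) * W' / W\<^sup>2 - z * (g * gv * q\<^sup>2 / W) = - (p * z * g * K)"
proof -
  define N where "N = p * p' + g * (gu * p + gv * q) * q\<^sup>2 + g\<^sup>2 * q * q'"
  define M where "M = q * (gv * p * q + 2 * gu * p\<^sup>2 + g\<^sup>2 * gu * q\<^sup>2) + g * (p * q' - p' * q)"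
  have nz: "x \<noteq> 0" "W \<noteq> 0" using assms(1,2) by auto
  have K': "W ^ 3 * x * K = - (x * M) - \<alpha> * g * q * W\<^sup>2"
    unfolding K M_def[symmetric] using nz by (simp add: field_simps power2_eq_square power3_eq_cube)
  have cancel: "r = s" if "W ^ 3 * x * r = W ^ 3 * x * s" for r s
    using that nz by simp
  show "(\<alpha> * (z / x) * p * p + z * p') / W - z * p * W' / W\<^sup>2
           - (\<alpha> * (z / x) * W + z * (g * gu * q\<^sup>2 / W)) = q * z * g * K" (is "?l = ?r")
  proof (rule cancel)
    have "W ^ 3 * x * ?l = z * (W\<^sup>2 * (\<alpha> * p * p + p' * x) - p * x * N
        - \<alpha> * (W\<^sup>2)\<^sup>2 - x * g * gu * q\<^sup>2 * W\<^sup>2)"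
      unfolding W' N_def[symmetric] using nz
      by (simp add: field_simps power2_eq_square power3_eq_cube)
    also have "\<dots> = q * z * g * (- (x * M) - \<alpha> * g * q * W\<^sup>2)"
      unfolding W2 N_def M_def by algebra
    also have "\<dots> = W ^ 3 * x * ?r"
      unfolding K'[symmetric] by (simp only: mult_ac mult_minus_right)
    finally show "W ^ 3 * x * ?l = W ^ 3 * x * ?r" .
  qed
  show "(\<alpha> * (z / x) * p * (g\<^sup>2 * q) + z * (2 * g * (gu * p + gv * q) * q + g\<^sup>2 * q')) / W
           - z * (g\<^sup>2 * q) * W' / W\<^sup>2 - z * (g * gv * q\<^sup>2 / W) = - (p * z * g * K)" (is "?l = ?r")
  proof (rule cancel)
    have "W ^ 3 * x * ?l = z * (W\<^sup>2 * (\<alpha> * p * g\<^sup>2 * q + x * (2 * g * (gu * p + gv * q) * q + g\<^sup>2 * q'))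
        - g\<^sup>2 * q * x * N - x * g * gv * q\<^sup>2 * W\<^sup>2)"
      unfolding W' N_def[symmetric] using nz
      by (simp add: field_simps power2_eq_square power3_eq_cube)
    also have "\<dots> = - (p * z * g * (- (x * M) - \<alpha> * g * q * W\<^sup>2))"
      unfolding W2 N_def M_def by algebra
    also have "\<dots> = W ^ 3 * x * ?r"
      unfolding K'[symmetric] by (simp only: mult_ac mult_minus_right)
    finally show "W ^ 3 * x * ?l = W ^ 3 * x * ?r" .
  qed
qed

lemma euler_lagrange_catenary_iff:
  assumes S: "riemannian_surface S" and co: "semigeodesic_coords S I l X D \<psi> G"
    and ab: "a < b" and u: "smooth_on {a..b} u" and v: "smooth_on {a..b} v"
    and D: "\<forall>t\<in>{a..b}. (u t, v t) \<in> D \<and> u t > 0"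
    and t: "t \<in> {a..b}" and nz: "(ddt a b u t, ddt a b v t) \<noteq> (0, 0)"
    and K: "K = geodesic_curvature G a b u v t - \<alpha> * (G (u t, v t) * ddt a b v t /
              (u t * sqrt ((ddt a b u t)\<^sup>2 + (G (u t, v t))\<^sup>2 * (ddt a b v t)\<^sup>2)))"
  shows "euler_lagrange_at (catenary_lagrangian S \<psi> (l ` I) \<alpha>) a b u v t \<longleftrightarrow>
    ddt a b v t * u t powr \<alpha> * G (u t, v t) * K = 0 \<and>
    ddt a b u t * u t powr \<alpha> * G (u t, v t) * K = 0"
proof -
  let ?L = "catenary_lagrangian S \<psi> (l ` I) \<alpha>"
  define p where "p s = ddt a b u s" for s
  define q where "q s = ddt a b v s" for s
  define g where "g s = G (u s, v s)" for s
  define z where "z s = u s powr \<alpha>" for s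
  define W where "W s = sqrt ((p s)\<^sup>2 + (g s)\<^sup>2 * (q s)\<^sup>2)" for s
  define p' where "p' = ddt a b p t"
  define q' where "q' = ddt a b q t"
  have "open D" "smooth_on D G" using co by (auto simp: semigeodesic_coords_def)
  have gpos: "g s > 0" if "s \<in> {a..b}" for s
    using co D that by (auto simp: semigeodesic_coords_def g_def)
  have xpos: "u t > 0" and xD: "(u t, v t) \<in> D" using D t by auto
  have L: "?L x y m n = x powr \<alpha> * sqrt (m\<^sup>2 + (G (x, y))\<^sup>2 * n\<^sup>2)" if "(x, y) \<in> D" "x > 0" for x y m n
    by (rule catenary_lagrangian_eq[OF S co that])

  have du: "(u has_real_derivative p t) (at t within {a..b})"
    and dv: "(v has_real_derivative q t) (at t within {a..b})"
    and dp: "(p has_real_derivative p') (at t within {a..b})"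
    and dq: "(q has_real_derivative q') (at t within {a..b})"
    using smooth_on_ddt[OF u ab t] smooth_on_ddt[OF v ab t]
    by (simp_all add: p_def[abs_def] q_def[abs_def] p'_def q'_def has_real_derivative_iff_has_vector_derivative)

  define F where "F = frechet_derivative G (at (u t, v t))"
  have "Ck_on (Suc 0) D G" using \<open>smooth_on D G\<close> by (simp only: smooth_on_def)
  then have "G differentiable at (u t, v t)"
    using \<open>open D\<close> xD by (metis Ck_on.simps(2) differentiable_on_def at_within_open)
  then have F: "(G has_derivative F) (at (u t, v t))"
    unfolding F_def by (simp add: frechet_derivative_works)
  define gu where "gu = F (1, 0)"
  define gv where "gv = F (0, 1)"
  have Gu: "((\<lambda>x. G (x, v t)) has_real_derivative gu) (at (u t))"
    and Gv: "((\<lambda>y. G (u t, y)) has_real_derivative gv) (at (v t))"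
    using has_derivative_prod_partials(1,2)[OF F] by (simp_all add: gu_def gv_def)
  have dg: "(g has_real_derivative gu * p t + gv * q t) (at t within {a..b})"
  proof -
    have "((\<lambda>s. (u s, v s)) has_vector_derivative (p t, q t)) (at t within {a..b})"
      using du dv
      by (intro has_vector_derivative_Pair) (simp_all add: has_real_derivative_iff_has_vector_derivative)
    from vector_derivative_diff_chain_within[OF this has_derivative_at_withinI[OF F]]
    show ?thesis
      using has_derivative_prod_partials(3)[OF F, of "p t" "q t"]
      by (simp add: has_real_derivative_iff_has_vector_derivative o_def g_def[abs_def] gu_def gv_def
          mult.commute)
  qed

  have nz': "(p t, q t) \<noteq> (0, 0)" using nz by (simp add: p_def q_def)
  note pos = speed_sq_pos[OF nz' gpos[OF t]]
  have Wpos: "W t > 0" and W2: "(W t)\<^sup>2 = (p t)\<^sup>2 + (g t)\<^sup>2 * (q t)\<^sup>2"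
    using pos by (simp_all add: W_def)
  define W' where "W' = (p t * p' + g t * (gu * p t + gv * q t) * (q t)\<^sup>2 + (g t)\<^sup>2 * q t * q') / W t"
  have dW: "(W has_real_derivative W') (at t within {a..b})"
    unfolding W_def[abs_def] W'_def by (rule has_real_derivative_sqrt_form[OF dp dg dq pos])
  have zx: "u t powr (\<alpha> - 1) = z t / u t" using xpos by (simp add: z_def powr_diff)
  have dz: "(z has_real_derivative \<alpha> * (z t / u t) * p t) (at t within {a..b})"
    unfolding z_def[abs_def] using DERIV_chain2[OF has_real_derivative_powr[OF xpos] du, of \<alpha>]
    by (simp add: zx z_def)

  have ev: "\<forall>\<^sub>F s in at t within {a..b}. s \<in> {a..b} \<and> (p s, q s) \<noteq> (0, 0)"
  proof -
    have "((\<lambda>s. (p s, q s)) \<longlongrightarrow> (p t, q t)) (at t within {a..b})"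
      using DERIV_continuous[OF dp] DERIV_continuous[OF dq]
      by (intro tendsto_Pair) (simp_all add: continuous_within)
    then have "\<forall>\<^sub>F s in at t within {a..b}. (p s, q s) \<noteq> (0, 0)"
      using nz' by (rule tendsto_imp_eventually_ne)
    moreover have "\<forall>\<^sub>F s in at t within {a..b}. s \<in> {a..b}"
      by (auto simp: eventually_at_filter)
    ultimately show ?thesis by (rule eventually_conj[rotated])
  qed

  have Lp: "deriv (\<lambda>m. ?L (u s) (v s) m (q s)) (p s) = z s * p s / W s"
    and Lq: "deriv (\<lambda>n. ?L (u s) (v s) (p s) n) (q s) = z s * ((g s)\<^sup>2 * q s) / W s"
    if s: "s \<in> {a..b} \<and> (p s, q s) \<noteq> (0, 0)" for s
  proof -
    have spos: "(p s)\<^sup>2 + (g s)\<^sup>2 * (q s)\<^sup>2 > 0" using speed_sq_pos gpos s by blast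
    have eqL: "?L (u s) (v s) m n = z s * sqrt (m\<^sup>2 + (g s)\<^sup>2 * n\<^sup>2)" for m n
      using L D s by (simp add: z_def g_def)
    have
      "((\<lambda>m. ?L (u s) (v s) m (q s)) has_real_derivative z s * p s / W s) (at (p s))"
      "((\<lambda>n. ?L (u s) (v s) (p s) n) has_real_derivative z s * ((g s)\<^sup>2 * q s) / W s) (at (q s))"
      using
        DERIV_cmult[OF has_real_derivative_sqrt_form[OF DERIV_ident DERIV_const DERIV_const spos], of "z s"]
        DERIV_cmult[OF has_real_derivative_sqrt_form[OF DERIV_const DERIV_const DERIV_ident spos], of "z s"]
      by (simp_all add: eqL W_def)
    then show "deriv (\<lambda>m. ?L (u s) (v s) m (q s)) (p s) = z s * p s / W s"
      and "deriv (\<lambda>n. ?L (u s) (v s) (p s) n) (q s) = z s * ((g s)\<^sup>2 * q s) / W s"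
      by (simp_all add: DERIV_imp_deriv)
  qed

  have Lx: "deriv (\<lambda>x. ?L x (v t) (p t) (q t)) (u t)
      = \<alpha> * (z t / u t) * W t + z t * (g t * gu * (q t)\<^sup>2 / W t)"
  proof (rule DERIV_imp_deriv)
    let ?A = "(\<lambda>x. (x, v t)) -` D \<inter> {0<..}"
    have "open ?A" using \<open>open D\<close>
      by (intro open_Int open_vimage continuous_intros) auto
    moreover have "u t \<in> ?A" using xD xpos by simp
    moreover have "((\<lambda>x. x powr \<alpha> * sqrt ((p t)\<^sup>2 + (G (x, v t))\<^sup>2 * (q t)\<^sup>2)) has_real_derivative
        \<alpha> * (z t / u t) * W t + z t * (g t * gu * (q t)\<^sup>2 / W t)) (at (u t))"
      using DERIV_mult[OF has_real_derivative_powr[OF xpos, of \<alpha>]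
          has_real_derivative_sqrt_form[OF DERIV_const Gu DERIV_const pos[unfolded g_def]]]
      by (simp add: zx W_def g_def z_def mult.commute)
    ultimately show "((\<lambda>x. ?L x (v t) (p t) (q t)) has_real_derivative
        \<alpha> * (z t / u t) * W t + z t * (g t * gu * (q t)\<^sup>2 / W t)) (at (u t))"
      by (rule_tac has_field_derivative_transform_within_open[where S = ?A]) (use L in auto)
  qed
  have Ly: "deriv (\<lambda>y. ?L (u t) y (p t) (q t)) (v t) = z t * (g t * gv * (q t)\<^sup>2 / W t)"
  proof (rule DERIV_imp_deriv)
    let ?A = "(\<lambda>y. (u t, y)) -` D"
    have "open ?A" using \<open>open D\<close> by (intro open_vimage continuous_intros) auto
    moreover have "v t \<in> ?A" using xD by simp
    moreover have "((\<lambda>y. z t * sqrt ((p t)\<^sup>2 + (G (u t, y))\<^sup>2 * (q t)\<^sup>2)) has_real_derivative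
        z t * (g t * gv * (q t)\<^sup>2 / W t)) (at (v t))"
      using DERIV_cmult[OF
          has_real_derivative_sqrt_form[OF DERIV_const Gv DERIV_const pos[unfolded g_def]], of "z t"]
      by (simp add: W_def g_def)
    ultimately show "((\<lambda>y. ?L (u t) y (p t) (q t)) has_real_derivative
        z t * (g t * gv * (q t)\<^sup>2 / W t)) (at (v t))"
      by (rule_tac has_field_derivative_transform_within_open[where S = ?A])
         (use L xpos in \<open>auto simp: z_def\<close>)
  qed

  define A where "A = (\<alpha> * (z t / u t) * p t * p t + z t * p') / W t - z t * p t * W' / (W t)\<^sup>2"
  define B where "B = (\<alpha> * (z t / u t) * p t * ((g t)\<^sup>2 * q t)
      + z t * (2 * g t * (gu * p t + gv * q t) * q t + (g t)\<^sup>2 * q')) / W t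
      - z t * ((g t)\<^sup>2 * q t) * W' / (W t)\<^sup>2"
  have "((\<lambda>s. z s * p s / W s) has_real_derivative A) (at t within {a..b})"
    by (rule DERIV_cong[OF DERIV_divide[OF DERIV_mult[OF dz dp] dW]])
       (use Wpos in \<open>simp_all add: A_def field_simps power2_eq_square\<close>)
  moreover have "((\<lambda>s. deriv (\<lambda>m. ?L (u s) (v s) m (q s)) (p s)) has_real_derivative r)
      (at t within {a..b}) \<longleftrightarrow> ((\<lambda>s. z s * p s / W s) has_real_derivative r) (at t within {a..b})" for r
    by (rule has_field_derivative_cong_eventually)
       (use eventually_mono[OF ev Lp] Lp t nz' in auto)
  ultimately have EL1: "((\<lambda>s. deriv (\<lambda>m. ?L (u s) (v s) m (q s)) (p s)) has_real_derivative r)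
      (at t within {a..b}) \<longleftrightarrow> A - r = 0" for r
    using has_real_derivative_iff_eq_Icc[OF ab t] by simp
  have "((\<lambda>s. z s * ((g s)\<^sup>2 * q s) / W s) has_real_derivative B) (at t within {a..b})"
    by (rule DERIV_cong[OF DERIV_divide[OF
            DERIV_mult[OF dz DERIV_mult[OF DERIV_power[OF dg, of 2] dq]] dW]])
       (use Wpos in \<open>simp_all add: B_def field_simps power2_eq_square\<close>)
  moreover have "((\<lambda>s. deriv (\<lambda>n. ?L (u s) (v s) (p s) n) (q s)) has_real_derivative r)
      (at t within {a..b}) \<longleftrightarrow>
      ((\<lambda>s. z s * ((g s)\<^sup>2 * q s) / W s) has_real_derivative r) (at t within {a..b})" for r
    by (rule has_field_derivative_cong_eventually)
       (use eventually_mono[OF ev Lq] Lq t nz' in auto)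
  ultimately have EL2: "((\<lambda>s. deriv (\<lambda>n. ?L (u s) (v s) (p s) n) (q s)) has_real_derivative r)
      (at t within {a..b}) \<longleftrightarrow> B - r = 0" for r
    using has_real_derivative_iff_eq_Icc[OF ab t] by simp

  have "((p t)\<^sup>2 + (g t)\<^sup>2 * (q t)\<^sup>2) powr (3/2) = W t ^ 3"
    using pos by (simp add: W_def powr_half_sqrt[symmetric] powr_powr flip: powr_realpow)
  then have K': "K = - (q t * (gv * p t * q t + 2 * gu * (p t)\<^sup>2 + (g t)\<^sup>2 * gu * (q t)\<^sup>2)
      + g t * (p t * q' - p' * q t)) / W t ^ 3 - \<alpha> * (g t * q t / (u t * W t))"
    unfolding K geodesic_curvature_def Let_def p_def[symmetric] q_def[symmetric] g_def[symmetric]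
    by (simp add: DERIV_imp_deriv[OF Gu] DERIV_imp_deriv[OF Gv] W_def p'_def q'_def)
  have "A - (\<alpha> * (z t / u t) * W t + z t * (g t * gu * (q t)\<^sup>2 / W t)) = q t * z t * g t * K"
    and "B - z t * (g t * gv * (q t)\<^sup>2 / W t) = - (p t * z t * g t * K)"
    unfolding A_def B_def
    by (rule euler_lagrange_residuals[OF xpos Wpos W2 W'_def K'])+
  then show ?thesis
    unfolding euler_lagrange_at_def p_def[symmetric] q_def[symmetric] EL1 EL2 Lx Ly
    by (simp flip: g_def z_def)
qed

theorem theorem2p2:
  fixes S :: "'a surface" and I :: "real set" and l :: "real \<Rightarrow> 'a" and X :: "real \<Rightarrow> 'a tvec"
    and D :: "(real \<times> real) set" and \<psi> :: "real \<times> real \<Rightarrow> 'a" and G :: "real \<times> real \<Rightarrow> real"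
    and \<alpha> a b :: real and u v :: "real \<Rightarrow> real" and \<gamma> :: "real \<Rightarrow> 'a"
  assumes "riemannian_surface S"
    and "semigeodesic_coords S I l X D \<psi> G"
    and "a < b"
    and "smooth_on {a..b} u" and "smooth_on {a..b} v"
    and "\<forall>t\<in>{a..b}. (u t, v t) \<in> D \<and> u t > 0"
    and "\<forall>t\<in>{a..b}. \<gamma> t = \<psi> (u t, v t)"
  shows "(alpha_catenary S \<psi> (l ` I) \<alpha> a b u v \<longleftrightarrow>
      (\<forall>t\<in>{a..b}.
        ddt a b v t * u t powr \<alpha> * G (u t, v t) *
          (geodesic_curvature G a b u v t
            - \<alpha> * (G (u t, v t) * ddt a b v t / (u t * speed S {a..b} \<gamma> t))) = 0 \<and>
        ddt a b u t * u t powr \<alpha> * G (u t, v t) *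
          (geodesic_curvature G a b u v t
            - \<alpha> * (G (u t, v t) * ddt a b v t / (u t * speed S {a..b} \<gamma> t))) = 0)) \<and>
    ((\<forall>t\<in>{a..b}. speed S {a..b} \<gamma> t \<noteq> 0) \<longrightarrow>
      (alpha_catenary S \<psi> (l ` I) \<alpha> a b u v \<longleftrightarrow>
      (\<forall>t\<in>{a..b}.
        geodesic_curvature G a b u v t
          = \<alpha> * (G (u t, v t) * ddt a b v t / (u t * speed S {a..b} \<gamma> t)) \<and>
        \<alpha> * (G (u t, v t) * ddt a b v t / (u t * speed S {a..b} \<gamma> t))
          = \<alpha> * (G (u t, v t) * ddt a b v t /
              (u t * sqrt ((ddt a b u t)\<^sup>2 + (G (u t, v t))\<^sup>2 * (ddt a b v t)\<^sup>2))))))"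
proof -
  note S = assms(1) and co = assms(2) and ab = assms(3) and u = assms(4) and v = assms(5)
    and D = assms(6) and eq = assms(7)
  let ?K = "\<lambda>t. geodesic_curvature G a b u v t
    - \<alpha> * (G (u t, v t) * ddt a b v t / (u t * speed S {a..b} \<gamma> t))"
  have sp: "speed S {a..b} \<gamma> t = sqrt ((ddt a b u t)\<^sup>2 + (G (u t, v t))\<^sup>2 * (ddt a b v t)\<^sup>2)"
    if "t \<in> {a..b}" for t
    by (rule speed_semigeodesic[OF S co ab that _ eq smooth_on_ddt(1)[OF u ab that]
          smooth_on_ddt(1)[OF v ab that]]) (use D that in blast)
  have EL: "((ddt a b u t, ddt a b v t) \<noteq> (0, 0) \<longrightarrow>
      euler_lagrange_at (catenary_lagrangian S \<psi> (l ` I) \<alpha>) a b u v t) \<longleftrightarrow>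
      ddt a b v t * u t powr \<alpha> * G (u t, v t) * ?K t = 0 \<and>
      ddt a b u t * u t powr \<alpha> * G (u t, v t) * ?K t = 0" if t: "t \<in> {a..b}" for t
  proof (cases "(ddt a b u t, ddt a b v t) = (0, 0)")
    case False
    then show ?thesis
      using euler_lagrange_catenary_iff[OF S co ab u v D t False refl, of \<alpha>] sp[OF t] by simp
  qed auto
  have reg: "ddt a b v t * u t powr \<alpha> * G (u t, v t) * ?K t = 0 \<and>
      ddt a b u t * u t powr \<alpha> * G (u t, v t) * ?K t = 0 \<longleftrightarrow> ?K t = 0"
    if t: "t \<in> {a..b}" and "speed S {a..b} \<gamma> t \<noteq> 0" for t
  proof -
    have "G (u t, v t) > 0" using co D t unfolding semigeodesic_coords_def by blast
    moreover have "u t powr \<alpha> > 0" using D t by force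
    moreover have "ddt a b u t \<noteq> 0 \<or> ddt a b v t \<noteq> 0"
      using that sp[OF t] by auto
    ultimately show ?thesis by auto
  qed
  show ?thesis
    unfolding alpha_catenary_def using EL reg sp by simp
qed

end
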